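(* Let $d,k\geq 1$ and $\epsilon\geq 0$ be integers. If there exists a $(d,k,+\epsilon)$-digraph, then for any integer $0\leq r\leq d$ there also exists a non-diregular $(d,k,+(\epsilon+1))$-digraph with minimum in-degree at most $d-r$.
   Context: A digraph is $k$-geodetic if for any two vertices $u,v$ there is at most one directed walk from $u$ to $v$ of length at most $k$. With $M(d,k)=1+d+\dots+d^k$, a $(d,k,+\epsilon)$-digraph is a $k$-geodetic digraph with minimum out-degree at least $d$ and order $M(d,k)+\epsilon$. A digraph is diregular if there is $c$ with $d^-(u)=d^+(u)=c$ for all vertices $u$. *)

theory Defs
  imports "Graph_Theory.Digraph" "Graph_Theory.Arc_Walk"
begin

(* The trivial walk counts as a walk of length 0 from u to u, so for k > 0 the
   condition also rules out directed cycles (loops included) of length at most k,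
   and parallel arcs. *)
definition geodetic :: "nat \<Rightarrow> ('a, 'b) pre_digraph \<Rightarrow> bool" where
  "geodetic k G \<longleftrightarrow>
     (\<forall>u \<in> verts G. \<forall>v \<in> verts G. \<forall>p q.
        pre_digraph.awalk G u p v \<and> length p \<le> k \<and>
        pre_digraph.awalk G u q v \<and> length q \<le> k \<longrightarrow> p = q)"

definition moore_bound :: "nat \<Rightarrow> nat \<Rightarrow> nat" where
  "moore_bound d k = (\<Sum>i\<le>k. d ^ i)"

(* The two minima are meaningful for digraphs with a finite, nonempty vertex set. *)
definition min_out_degree :: "('a, 'b) pre_digraph \<Rightarrow> nat" where
  "min_out_degree G = Min (out_degree G ` verts G)"

definition min_in_degree :: "('a, 'b) pre_digraph \<Rightarrow> nat" where
  "min_in_degree G = Min (in_degree G ` verts G)"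

definition excess_digraph :: "nat \<Rightarrow> nat \<Rightarrow> nat \<Rightarrow> ('a, 'b) pre_digraph \<Rightarrow> bool" where
  "excess_digraph d k \<epsilon> G \<longleftrightarrow>
     digraph G \<and> geodetic k G \<and> d \<le> min_out_degree G \<and>
     card (verts G) = moore_bound d k + \<epsilon>"

definition diregular :: "('a, 'b) pre_digraph \<Rightarrow> bool" where
  "diregular G \<longleftrightarrow> (\<exists>c. \<forall>u \<in> verts G. in_degree G u = c \<and> out_degree G u = c)"

end

theory Submission
  imports Defs
begin

text \<open>
  Add one vertex \<open>n\<close> without in-arcs whose out-neighbours are those of a fixed vertex \<open>u\<close> of the
  given digraph \<open>G\<close>. Collapsing \<open>n\<close> to \<open>u\<close> is a homomorphism onto \<open>G\<close> that is injective on the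
  out-arcs of every vertex, so distinct walks with the same origin have distinct images and
  geodecity is inherited from \<open>G\<close>. The in-degree of \<open>n\<close> is \<open>0\<close>, which works for all \<open>r\<close> at once.
\<close>

lemma cas_map:
  assumes "\<And>e. e \<in> set p \<Longrightarrow> tail G (\<phi> e) = g (tail H e) \<and> head G (\<phi> e) = g (head H e)"
    and "pre_digraph.cas H x p y"
  shows "pre_digraph.cas G (g x) (map \<phi> p) (g y)"
  using assms by (induction p arbitrary: x) (auto simp: pre_digraph.cas.simps)

text \<open>Injectivity is only local, so the walk is recovered arc by arc: the first arcs both
  leave \<open>x\<close>, hence agree, and the remaining walks again share their origin.\<close>

lemma awalk_map_inj:
  assumes inj: "\<And>x. inj_on \<phi> (out_arcs H x)"
    and "pre_digraph.awalk H x p y" "pre_digraph.awalk H x q z"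
    and "map \<phi> p = map \<phi> q"
  shows "p = q"
proof -
  \<comment> \<open>\<open>awalk\<close> is split into arc membership and \<open>cas\<close>, both
    of which pass directly to the rest of the walk after its first arc.\<close>
  have "p = q" if "set p \<subseteq> arcs H" "set q \<subseteq> arcs H"
    "pre_digraph.cas H x p y" "pre_digraph.cas H x q z" "map \<phi> p = map \<phi> q" for x p q
    using that
  proof (induction p arbitrary: x q)
    case Nil
    then show ?case by simp
  next
    case (Cons a p)
    then obtain b q' where q: "q = b # q'" by (cases q) auto
    have "a \<in> out_arcs H x" "b \<in> out_arcs H x" "\<phi> a = \<phi> b"
      using Cons.prems by (auto simp: q pre_digraph.cas.simps)
    then have "a = b" using inj by (meson inj_onD)
    moreover have "p = q'"
      using Cons.IH[of q' "head H a"] Cons.prems \<open>a = b\<close> by (auto simp: q pre_digraph.cas.simps)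
    ultimately show ?case by (simp add: q)
  qed
  then show ?thesis using assms by (auto simp: pre_digraph.awalk_def)
qed

text \<open>Mapping arcs preserves length, so two short walks from \<open>x\<close> to
  \<open>y\<close> have the same image in \<open>G\<close> by geodecity;
  \<open>awalk_map_inj\<close> lifts this equality back. The vertex map \<open>g\<close> may
  identify vertices.\<close>

lemma geodetic_pullback:
  assumes G: "geodetic k G"
    and verts: "\<And>x. x \<in> verts H \<Longrightarrow> g x \<in> verts G"
    and arcs: "\<And>e. e \<in> arcs H \<Longrightarrow>
      \<phi> e \<in> arcs G \<and> tail G (\<phi> e) = g (tail H e) \<and> head G (\<phi> e) = g (head H e)"
    and inj: "\<And>x. inj_on \<phi> (out_arcs H x)"
  shows "geodetic k H"
proof -
  have walk: "pre_digraph.awalk G (g x) (map \<phi> p) (g y)" if "pre_digraph.awalk H x p y" for x p y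
    using that verts arcs cas_map[of p G \<phi> g H x y]
    by (auto simp: pre_digraph.awalk_def subset_iff)
  show ?thesis
    unfolding geodetic_def
  proof (intro ballI allI impI, elim conjE)
    fix x y p q
    assume xy: "x \<in> verts H" "y \<in> verts H"
      and p: "pre_digraph.awalk H x p y" "length p \<le> k"
      and q: "pre_digraph.awalk H x q y" "length q \<le> k"
    have "\<forall>p q. pre_digraph.awalk G (g x) p (g y) \<and> length p \<le> k \<and>
        pre_digraph.awalk G (g x) q (g y) \<and> length q \<le> k \<longrightarrow> p = q"
      using G[unfolded geodetic_def, rule_format, OF verts[OF xy(1)] verts[OF xy(2)]] by blast
    then have "map \<phi> p = map \<phi> q" using walk p q by simp
    then show "p = q" using awalk_map_inj[OF inj] p q by blast
  qed
qed

text \<open>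
  The digraph \<open>G\<close> with one source added, on the vertices \<open>0, \<dots>, n\<close>: here \<open>g\<close> enumerates the
  vertices of \<open>G\<close> on \<open>{..<n}\<close>, and \<open>g n\<close> is the vertex whose out-neighbours the source \<open>n\<close> copies.
\<close>

definition add_source :: "nat \<Rightarrow> (nat \<Rightarrow> 'a) \<Rightarrow> ('a, 'b) pre_digraph \<Rightarrow> (nat, nat \<times> nat) pre_digraph"
  where "add_source n g G = \<lparr>verts = {..n},
    arcs = {(x, y). x \<le> n \<and> y < n \<and> (g x, g y) \<in> arcs_ends G}, tail = fst, head = snd\<rparr>"

lemma add_source_simps [simp]:
  "verts (add_source n g G) = {..n}"
  "arcs (add_source n g G) = {(x, y). x \<le> n \<and> y < n \<and> (g x, g y) \<in> arcs_ends G}"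
  "tail (add_source n g G) = fst"
  "head (add_source n g G) = snd"
  by (simp_all add: add_source_def)

lemma in_degree_add_source: "in_degree (add_source n g G) n = 0"
proof -
  have "in_arcs (add_source n g G) n = {}" by (auto simp: in_arcs_def)
  then show ?thesis by (simp add: in_degree_def)
qed

locale source_extension = digraph G for G :: "('a, 'b) pre_digraph" +
  fixes n :: nat and g :: "nat \<Rightarrow> 'a"
  assumes bij: "bij_betw g {..<n} (verts G)"
    and source: "g n \<in> verts G"
begin

abbreviation "H \<equiv> add_source n g G"

text \<open>Arcs of \<open>H\<close> are pairs, those of \<open>G\<close> have an arbitrary type. On
  arcs of \<open>H\<close> the choice made by \<open>inv_into\<close> is unique, since
  \<open>G\<close> has no parallel arcs.\<close>

definition collapse :: "nat \<times> nat \<Rightarrow> 'b" where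
  "collapse e = inv_into (arcs G) (arc_to_ends G) (g (fst e), g (snd e))"

lemma g_in_verts: "x \<le> n \<Longrightarrow> g x \<in> verts G"
  using bij source by (cases "x = n") (auto simp: bij_betw_def)

lemma digraph_add_source: "digraph H"
proof
  have "arcs H \<subseteq> {..n} \<times> {..n}" by auto
  then show "finite (arcs H)" by (rule finite_subset) simp
  show "tail H e \<noteq> head H e" if "e \<in> arcs H" for e
    using that adj_not_same by auto
qed (auto simp: arc_to_ends_def)

lemma collapse_arc:
  assumes "e \<in> arcs H"
  shows "collapse e \<in> arcs G \<and> tail G (collapse e) = g (fst e) \<and> head G (collapse e) = g (snd e)"
proof -
  have ends: "(g (fst e), g (snd e)) \<in> arc_to_ends G ` arcs G"
    using assms by (auto simp: arcs_ends_def)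
  show ?thesis
    using inv_into_into[OF ends] f_inv_into_f[OF ends] by (simp add: collapse_def arc_to_ends_def)
qed

text \<open>Although \<open>g\<close> repeats a value at \<open>n\<close>, no arc enters
  \<open>n\<close>: all heads lie in \<open>{..<n}\<close>, where \<open>g\<close> is injective, and
  the tails agree by assumption.\<close>

lemma inj_on_collapse: "inj_on collapse (out_arcs H x)"
proof (rule inj_onI)
  fix e e' assume e: "e \<in> out_arcs H x" "e' \<in> out_arcs H x" "collapse e = collapse e'"
  then have "g (snd e) = g (snd e')" using collapse_arc[of e] collapse_arc[of e'] by auto
  then have "snd e = snd e'"
    using e bij by (auto simp: bij_betw_def out_arcs_def dest: inj_onD)
  then show "e = e'" using e by (auto simp: out_arcs_def prod_eq_iff)
qed

lemma geodetic_add_source: "geodetic k G \<Longrightarrow> geodetic k H"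
  by (rule geodetic_pullback[where g = g and \<phi> = collapse])
    (use g_in_verts collapse_arc inj_on_collapse in auto)

text \<open>Every arc leaving \<open>g x\<close> is hit by \<open>collapse\<close>: its head is
  \<open>g y\<close> for some \<open>y < n\<close>, and \<open>(x, y)\<close> is an arc of
  \<open>H\<close> above it.\<close>

lemma out_degree_add_source:
  assumes "x \<le> n"
  shows "out_degree G (g x) \<le> out_degree H x"
proof -
  interpret H: digraph H by (rule digraph_add_source)
  have "out_arcs G (g x) \<subseteq> collapse ` out_arcs H x"
  proof
    fix a assume a: "a \<in> out_arcs G (g x)"
    then have "head G a \<in> g ` {..<n}" using bij by (auto simp: bij_betw_def)
    then obtain y where y: "y < n" "g y = head G a" by auto
    then have e: "(x, y) \<in> arcs H"
      using a assms by (auto simp: arcs_ends_def arc_to_ends_def image_iff intro!: bexI[of _ a])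
    have "collapse (x, y) = a"
      by (rule no_multi_arcs) (use collapse_arc[OF e] a y in \<open>auto simp: arc_to_ends_def\<close>)
    then show "a \<in> collapse ` out_arcs H x" using e by (force simp: out_arcs_def)
  qed
  then show ?thesis unfolding out_degree_def by (intro surj_card_le H.finite_out_arcs)
qed

lemma min_out_degree_add_source: "min_out_degree G \<le> min_out_degree H"
proof -
  have "min_out_degree G \<le> out_degree H x" if "x \<le> n" for x
  proof -
    have "min_out_degree G \<le> out_degree G (g x)"
      using g_in_verts[OF that] by (simp add: min_out_degree_def)
    then show ?thesis using out_degree_add_source[OF that] by (rule order_trans)
  qed
  then show ?thesis unfolding min_out_degree_def[of H] by (intro Min.boundedI) auto
qed

lemma min_in_degree_add_source: "min_in_degree H = 0"
proof -
  have "min_in_degree H \<le> in_degree H n" by (simp add: min_in_degree_def)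
  then show ?thesis by (simp add: in_degree_add_source)
qed

text \<open>The source \<open>n\<close> has in-degree 0 but inherits a positive out-degree.\<close>

lemma not_diregular_add_source:
  assumes "min_out_degree G > 0"
  shows "\<not> diregular H"
proof
  assume "diregular H"
  then obtain c where "in_degree H n = c" "out_degree H n = c" by (auto simp: diregular_def)
  then have "out_degree H n = 0" by (simp add: in_degree_add_source)
  moreover have "min_out_degree H \<le> out_degree H n" by (simp add: min_out_degree_def)
  ultimately show False using assms min_out_degree_add_source by simp
qed

end

theorem theorem11:
  fixes d k \<epsilon> r :: nat
  assumes "d \<ge> 1" and "k \<ge> 1"
    and "\<exists>G :: ('a, 'b) pre_digraph. excess_digraph d k \<epsilon> G"
    and "r \<le> d"
  shows "\<exists>H :: (nat, nat \<times> nat) pre_digraph.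
           excess_digraph d k (\<epsilon> + 1) H \<and> \<not> diregular H \<and> min_in_degree H \<le> d - r"
proof -
  from assms(3) obtain G :: "('a, 'b) pre_digraph" where "digraph G"
    and geo: "geodetic k G" and deg: "d \<le> min_out_degree G"
    and card: "card (verts G) = moore_bound d k + \<epsilon>"
    by (auto simp: excess_digraph_def)
  interpret digraph G by fact
  \<comment> \<open>This guarantees a vertex to copy; any choice of it will do.\<close>
  have "moore_bound d k > 0" using \<open>d \<ge> 1\<close> by (auto simp: moore_bound_def intro!: sum_pos)
  then have "verts G \<noteq> {}" using card by auto
  then obtain u where u: "u \<in> verts G" by blast
  define n where "n = card (verts G)"
  obtain h where h: "bij_betw h {..<n} (verts G)"
    using ex_bij_betw_nat_finite[OF finite_verts] by (auto simp: n_def atLeast0LessThan)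
  \<comment> \<open>The enumeration uses only indices below \<open>n\<close>, so the value at
    \<open>n\<close> is free to name the copied vertex \<open>u\<close>.\<close>
  interpret source_extension G n "h(n := u)"
  proof
    show "bij_betw (h(n := u)) {..<n} (verts G)"
      using h by (subst bij_betw_cong[where g = h]) auto
  qed (use u in simp)
  have "excess_digraph d k (\<epsilon> + 1) H"
    using digraph_add_source geodetic_add_source[OF geo] deg min_out_degree_add_source card
    by (simp add: excess_digraph_def n_def)
  moreover have "\<not> diregular H" using deg \<open>d \<ge> 1\<close> by (intro not_diregular_add_source) simp
  ultimately show ?thesis using min_in_degree_add_source by auto
qed

end
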